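(* Let $H,B,\lambda,\Delta>0$ and let $\mathcal{A}$ be a linear update algorithm which, when executed for $T$ iterations with stochastic gradients of variance at most $\sigma^2$, guarantees $\mathbb{E}F(x_T)-F^*\le\epsilon_0(T,\sigma^2)$ for any quadratic $F\in\mathcal{F}_0(H,B)$, and guarantees $\mathbb{E}F(x_T)-F^*\le\epsilon_\lambda(T,\sigma^2)$ for any quadratic $F\in\mathcal{F}_\lambda(H,\Delta)$ (for all $T$ and $\sigma^2$). Then for all $M,K,R\ge1$, when Local-$\mathcal{A}$ is run with $M$ machines, $R$ rounds of communication and $K$ steps per round, with stochastic gradients of variance at most $\sigma^2$, its averaged final iterate $\bar x_{KR}=\frac1M\sum_{m=1}^M x^m_{KR}$ satisfies $$\mathbb{E}F(\bar x_{KR})-F^*\le\epsilon_0\Big(KR,\frac{\sigma^2}{M}\Big)\quad\text{for every quadratic }F\in\mathcal{F}_0(H,B),$$ and $$\mathbb{E}F(\bar x_{KR})-F^*\le\epsilon_\lambda\Big(KR,\frac{\sigma^2}{M}\Big)\quad\text{for every quadratic }F\in\mathcal{F}_\lambda(H,\Delta).$$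
   Context: $\mathcal{F}_0(H,B)$: convex, $H$-smooth (gradient $H$-Lipschitz) functions $F:\mathbb{R}^d\to\mathbb{R}$, $d\in\mathbb N$, with a minimizer $x^*$ such that $\|x^*\|\le B$. $\mathcal{F}_\lambda(H,\Delta)$: $\lambda$-strongly convex, $H$-smooth functions with $F(0)-\min_xF(x)\le\Delta$. $F^*=\min F$. Stochastic gradients: $g(x;z)$ denotes a stochastic gradient, unbiased for $\nabla F(x)$ with variance $\mathbb{E}\|g(x;z)-\nabla F(x)\|^2\le\sigma^2$; the draws are independent across machines and steps. The guarantees assumed for $\mathcal{A}$ use no structure of the stochastic gradients beyond this: they hold whenever each stochastic gradient used by $\mathcal{A}$ is, conditionally on the past, unbiased with variance at most the stated bound. Linear update algorithm: a sequential stochastic first-order algorithm such that, for fixed linear functions $\mathcal{L}_1^{(t)},\mathcal{L}_2^{(t)}$, its iterates satisfy $$x_{t+1}=\mathcal{L}_2^{(t)}\Big(x_1,\dots,x_t,\ g\big(\mathcal{L}_1^{(t)}(x_1,\dots,x_t);z_t\big)\Big).$$ Local-$\mathcal{A}$: $M$ machines start from the same initialization as $\mathcal A$; during each round of communication each machine $m$ independently executes $K$ iterations of $\mathcal{A}$ (with its own independent stochastic gradients), continuing the iteration count across rounds, and at the end of each round the $M$ local iterates are replaced on every machine by their average over machines. There are $R$ rounds, $KR$ iterations in total per machine, and $x_t^m$ denotes the $t$-th iterate on machine $m$. *)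

theory Defs
  imports "HOL-Probability.Probability"
begin

definition gradient :: "('a::real_inner \<Rightarrow> real) \<Rightarrow> 'a \<Rightarrow> 'a" where
  "gradient F x = (THE D. GDERIV F x :> D)"

definition smooth :: "real \<Rightarrow> ('a::euclidean_space \<Rightarrow> real) \<Rightarrow> bool" where
  "smooth H F \<longleftrightarrow> (\<forall>x. F differentiable (at x)) \<and> H-lipschitz_on UNIV (gradient F)"

definition strongly_convex :: "real \<Rightarrow> ('a::real_inner \<Rightarrow> real) \<Rightarrow> bool" where
  "strongly_convex lam F \<longleftrightarrow>
     (\<forall>x y. \<forall>u\<in>{0..1}. F ((1 - u) *\<^sub>R x + u *\<^sub>R y)
        \<le> (1 - u) * F x + u * F y - lam / 2 * u * (1 - u) * (norm (x - y))\<^sup>2)"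

text \<open>On both function classes below the infimum is attained, so this is the minimum.\<close>

definition min_value :: "('a \<Rightarrow> real) \<Rightarrow> real" where
  "min_value F = (INF x. F x)"

definition convex_class :: "real \<Rightarrow> real \<Rightarrow> ('a::euclidean_space \<Rightarrow> real) set" where
  "convex_class H B = {F. convex_on UNIV F \<and> smooth H F \<and>
     (\<exists>xs. (\<forall>x. F xs \<le> F x) \<and> norm xs \<le> B)}"

definition strongly_convex_class ::
    "real \<Rightarrow> real \<Rightarrow> real \<Rightarrow> ('a::euclidean_space \<Rightarrow> real) set" where
  "strongly_convex_class lam H \<Delta> = {F. strongly_convex lam F \<and> smooth H F \<and>
     F 0 - min_value F \<le> \<Delta>}"

definition quadratic :: "(real ^ 'n \<Rightarrow> real) \<Rightarrow> bool" where
  "quadratic F \<longleftrightarrow> (\<exists>Q b c. \<forall>x. F x = 1 / 2 * (x \<bullet> (Q *v x)) + b \<bullet> x + c)"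

text \<open>
  \<open>linear_of_first n L\<close>: \<open>L\<close> is a linear function of the first \<open>n\<close> vectors
  \<open>x 0, \<dots>, x (n - 1)\<close> of a sequence.
\<close>

definition linear_of_first :: "nat \<Rightarrow> ((nat \<Rightarrow> 'a::real_vector) \<Rightarrow> 'a) \<Rightarrow> bool" where
  "linear_of_first n L \<longleftrightarrow>
     (\<forall>x y. (\<forall>s<n. x s = y s) \<longrightarrow> L x = L y) \<and>
     (\<forall>x y. L (\<lambda>s. x s + y s) = L x + L y) \<and>
     (\<forall>c x. L (\<lambda>s. c *\<^sub>R x s) = c *\<^sub>R L x)"

text \<open>
  \<open>x 0\<close> is the initialization, and iteration \<open>t\<close> uses one stochastic gradient, taken at
  \<open>query A t (x 0, \<dots>, x t)\<close>, to produce \<open>x (Suc t)\<close>; thus \<open>x T\<close> is the result of \<open>T\<close> iterations.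
  The function \<open>update A t\<close> takes the \<open>t + 2\<close> vectors \<open>x 0, \<dots>, x t\<close> and the stochastic
  gradient, which is passed as entry \<open>Suc t\<close> of the sequence.
\<close>

record 'a algorithm =
  init :: 'a
  query :: "nat \<Rightarrow> (nat \<Rightarrow> 'a) \<Rightarrow> 'a"
  update :: "nat \<Rightarrow> (nat \<Rightarrow> 'a) \<Rightarrow> 'a"

definition linear_update_algorithm :: "'a::real_vector algorithm \<Rightarrow> bool" where
  "linear_update_algorithm A \<longleftrightarrow>
     (\<forall>t. linear_of_first (Suc t) (query A t) \<and> linear_of_first (Suc (Suc t)) (update A t))"

definition step :: "'a algorithm \<Rightarrow> nat \<Rightarrow> (nat \<Rightarrow> 'a) \<Rightarrow> ('a \<Rightarrow> 'a) \<Rightarrow> 'a" where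
  "step A t x G = update A t (x(Suc t := G (query A t x)))"

text \<open>
  In \<open>history\<close> and \<open>local_history\<close> at time \<open>t\<close>, only the entries \<open>0, \<dots>, t\<close> are meaningful.
  \<open>G t y\<close> (respectively \<open>G m t y\<close>, on machine \<open>m\<close>) is the stochastic gradient returned in
  iteration \<open>t\<close> for the query point \<open>y\<close>.
\<close>

primrec history :: "'a algorithm \<Rightarrow> (nat \<Rightarrow> 'a \<Rightarrow> 'a) \<Rightarrow> nat \<Rightarrow> nat \<Rightarrow> 'a" where
  "history A G 0 = (\<lambda>s. init A)"
| "history A G (Suc t) = (history A G t)(Suc t := step A t (history A G t) (G t))"

definition iterate :: "'a algorithm \<Rightarrow> (nat \<Rightarrow> 'a \<Rightarrow> 'a) \<Rightarrow> nat \<Rightarrow> 'a" where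
  "iterate A G t = history A G t t"

definition query_point :: "'a algorithm \<Rightarrow> (nat \<Rightarrow> 'a \<Rightarrow> 'a) \<Rightarrow> nat \<Rightarrow> 'a" where
  "query_point A G t = query A t (history A G t)"

text \<open>
  Machines are numbered \<open>0, \<dots>, M - 1\<close>. A round ends whenever the iteration count reaches a
  multiple of \<open>K\<close>; the local iterates \<open>x m (Suc t)\<close> are then replaced by their average, which is
  also what later iterations see as entry \<open>Suc t\<close> of the history. Earlier entries are kept.
\<close>

primrec local_history ::
    "'a::real_vector algorithm \<Rightarrow> nat \<Rightarrow> nat \<Rightarrow> (nat \<Rightarrow> nat \<Rightarrow> 'a \<Rightarrow> 'a) \<Rightarrow> nat \<Rightarrow> nat \<Rightarrow> nat \<Rightarrow> 'a"
where
  "local_history A M K G 0 = (\<lambda>m s. init A)"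
| "local_history A M K G (Suc t) =
     (let x = local_history A M K G t;
          y = (\<lambda>m. step A t (x m) (G m t))
      in (\<lambda>m. (x m)(Suc t := if K dvd Suc t then (1 / real M) *\<^sub>R (\<Sum>j<M. y j) else y m)))"

definition local_iterate ::
    "'a::real_vector algorithm \<Rightarrow> nat \<Rightarrow> nat \<Rightarrow> (nat \<Rightarrow> nat \<Rightarrow> 'a \<Rightarrow> 'a) \<Rightarrow> nat \<Rightarrow> nat \<Rightarrow> 'a" where
  "local_iterate A M K G m t = local_history A M K G t m t"

definition averaged_iterate ::
    "'a::real_vector algorithm \<Rightarrow> nat \<Rightarrow> nat \<Rightarrow> (nat \<Rightarrow> nat \<Rightarrow> 'a \<Rightarrow> 'a) \<Rightarrow> nat \<Rightarrow> 'a" where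
  "averaged_iterate A M K G t = (1 / real M) *\<^sub>R (\<Sum>m<M. local_iterate A M K G m t)"

text \<open>
  A process \<open>g\<close> of stochastic gradients used in a run of \<open>A\<close> for \<open>T\<close> iterations, each of which is,
  conditionally on the past, an unbiased estimate of the gradient of \<open>F\<close> at the query point with
  variance at most \<open>v\<close>. The past before iteration \<open>t\<close> is represented by \<open>\<F> t\<close>. Conditional
  expectations of vectors are taken componentwise.
\<close>

definition conditionally_unbiased_run ::
    "'w measure \<Rightarrow> (nat \<Rightarrow> 'w measure) \<Rightarrow> (real ^ 'n) algorithm \<Rightarrow> (real ^ 'n \<Rightarrow> real) \<Rightarrow> real \<Rightarrow> nat
      \<Rightarrow> (nat \<Rightarrow> 'w \<Rightarrow> real ^ 'n) \<Rightarrow> bool" where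
  "conditionally_unbiased_run P \<F> A F v T g \<longleftrightarrow>
     prob_space P \<and> filtration (space P) \<F> \<and> (\<forall>t. subalgebra P (\<F> t)) \<and>
     (\<forall>t<T. g t \<in> borel_measurable (\<F> (Suc t)) \<and>
        (let d = (\<lambda>\<omega>. gradient F (query_point A (\<lambda>s _. g s \<omega>) t))
         in integrable P (g t) \<and>
            (\<forall>i. AE \<omega> in P. real_cond_exp P (\<F> t) (\<lambda>\<omega>. g t \<omega> $ i) \<omega> = d \<omega> $ i) \<and>
            integrable P (\<lambda>\<omega>. (norm (g t \<omega> - d \<omega>))\<^sup>2) \<and>
            (AE \<omega> in P. real_cond_exp P (\<F> t) (\<lambda>\<omega>. (norm (g t \<omega> - d \<omega>))\<^sup>2) \<omega> \<le> v)))"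

text \<open>
  The type argument is the type of the outcomes of the underlying probability spaces, over which
  HOL cannot quantify inside a formula. A theorem that assumes \<open>guarantees\<close> only for the type on
  which its own conclusion is formulated assumes less than the guarantee for all probability
  spaces. The same holds for the dimension of the domain of the functions in \<open>C\<close>.
\<close>

definition guarantees ::
    "'w itself \<Rightarrow> (real ^ 'n) algorithm \<Rightarrow> (real ^ 'n \<Rightarrow> real) set \<Rightarrow> (nat \<Rightarrow> real \<Rightarrow> real) \<Rightarrow> bool" where
  "guarantees TYPE('w) A C \<epsilon> \<longleftrightarrow>
     (\<forall>F\<in>C. \<forall>T\<ge>1. \<forall>v\<ge>0. \<forall>(P :: 'w measure) \<F> g.
        conditionally_unbiased_run P \<F> A F v T g \<longrightarrow>
        prob_space.expectation P (\<lambda>\<omega>. F (iterate A (\<lambda>t _. g t \<omega>) T)) - min_value F \<le> \<epsilon> T v)"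

text \<open>
  \<open>g x (z m t \<omega>)\<close> is the stochastic gradient at \<open>x\<close> that machine \<open>m\<close> obtains in iteration \<open>t\<close>. The
  draws \<open>z m t\<close> are independent for \<open>m < M\<close> and \<open>t < T\<close>, but need not be identically distributed.
\<close>

definition stochastic_gradients ::
    "'w measure \<Rightarrow> 'z measure \<Rightarrow> (real ^ 'n \<Rightarrow> real) \<Rightarrow> real \<Rightarrow> nat \<Rightarrow> nat
      \<Rightarrow> (real ^ 'n \<Rightarrow> 'z \<Rightarrow> real ^ 'n) \<Rightarrow> (nat \<Rightarrow> nat \<Rightarrow> 'w \<Rightarrow> 'z) \<Rightarrow> bool" where
  "stochastic_gradients P Z F v M T g z \<longleftrightarrow>
     prob_space P \<and>
     (\<lambda>(x, \<zeta>). g x \<zeta>) \<in> borel_measurable (borel \<Otimes>\<^sub>M Z) \<and>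
     prob_space.indep_vars P (\<lambda>_. Z) (\<lambda>(m, t). z m t) ({..<M} \<times> {..<T}) \<and>
     (\<forall>m<M. \<forall>t<T. \<forall>x.
        integrable P (\<lambda>\<omega>. g x (z m t \<omega>)) \<and>
        prob_space.expectation P (\<lambda>\<omega>. g x (z m t \<omega>)) = gradient F x \<and>
        integrable P (\<lambda>\<omega>. (norm (g x (z m t \<omega>) - gradient F x))\<^sup>2) \<and>
        prob_space.expectation P (\<lambda>\<omega>. (norm (g x (z m t \<omega>) - gradient F x))\<^sup>2) \<le> v)"

end

theory Submission
  imports Defs
begin

text \<open>
  For a quadratic \<open>F\<close> the gradient is affine, and the updates are linear, so averaging commutes with
  every step: the average of the local iterates is itself a run of \<open>A\<close>, whose stochastic gradient in
  each iteration is the mean of the \<open>M\<close> local ones. Averaging at the end of a round does not change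
  the mean. The mean gradient is unbiased at the averaged query point since \<open>\<nabla>F\<close> is affine, and by
  independence of the machines its variance is at most \<open>\<sigma>\<^sup>2 / M\<close>, conditionally on all earlier draws.
  The guarantee of \<open>A\<close> with variance \<open>\<sigma>\<^sup>2 / M\<close> then applies to this run.
\<close>

section \<open>Linear functions of finitely many vectors\<close>

lemma linear_of_first_add:
  "linear_of_first n L \<Longrightarrow> L (\<lambda>s. x s + y s) = L x + L y"
  by (simp add: linear_of_first_def)

lemma linear_of_first_scaleR:
  "linear_of_first n L \<Longrightarrow> L (\<lambda>s. c *\<^sub>R x s) = c *\<^sub>R L x"
  by (simp add: linear_of_first_def)

lemma linear_of_first_cong:
  "linear_of_first n L \<Longrightarrow> (\<And>s. s < n \<Longrightarrow> x s = y s) \<Longrightarrow> L x = L y"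
  by (simp add: linear_of_first_def)

lemma linear_of_first_sum:
  assumes "linear_of_first n L"
  shows "L (\<lambda>s. \<Sum>i\<in>I. x i s) = (\<Sum>i\<in>I. L (x i))"
proof -
  have "L (\<lambda>s. 0) = 0"
    using linear_of_first_scaleR[OF assms, of 0 "\<lambda>s. 0"] by simp
  then show ?thesis
    by (induction I rule: infinite_finite_induct)
      (simp_all add: linear_of_first_add[OF assms])
qed

lemma linear_of_first_mean:
  assumes "linear_of_first n L"
  shows "L (\<lambda>s. c *\<^sub>R (\<Sum>i\<in>I. x i s)) = c *\<^sub>R (\<Sum>i\<in>I. L (x i))"
  using linear_of_first_scaleR[OF assms] linear_of_first_sum[OF assms] by metis

text \<open>Applying \<open>L\<close> to a sequence supported on the single index \<open>s\<close>
  isolates the coefficient \<open>l s\<close>, which is bounded because the space is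
  finite-dimensional. Measurability and integrability of \<open>L\<close> applied to random vectors
  thereby reduce to finite sums.\<close>

lemma linear_of_first_coefficients:
  fixes L :: "(nat \<Rightarrow> 'a::euclidean_space) \<Rightarrow> 'a"
  assumes L: "linear_of_first n L"
  obtains l where "\<And>s. bounded_linear (l s)" "\<And>x. L x = (\<Sum>s<n. l s (x s))"
proof
  define l where "l s v = L (\<lambda>r. if r = s then v else 0)" for s v
  show "bounded_linear (l s)" for s
  proof (rule linear_conv_bounded_linear[THEN iffD1], rule linearI)
    show "l s (u + v) = l s u + l s v" for u v
      unfolding l_def linear_of_first_add[OF L, symmetric]
      by (intro linear_of_first_cong[OF L]) auto
    show "l s (c *\<^sub>R u) = c *\<^sub>R l s u" for c u
      unfolding l_def linear_of_first_scaleR[OF L, symmetric]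
      by (intro linear_of_first_cong[OF L]) auto
  qed
  show "L x = (\<Sum>s<n. l s (x s))" for x
    unfolding l_def linear_of_first_sum[OF L, symmetric]
    by (intro linear_of_first_cong[OF L]) simp
qed

lemma borel_measurable_linear_of_first:
  fixes x :: "nat \<Rightarrow> 'w \<Rightarrow> 'a::euclidean_space"
  assumes "linear_of_first n L" and x: "\<And>s. s < n \<Longrightarrow> x s \<in> borel_measurable N"
  shows "(\<lambda>\<omega>. L (\<lambda>s. x s \<omega>)) \<in> borel_measurable N"
proof -
  obtain l where l: "\<And>s. bounded_linear (l s)" "\<And>y. L y = (\<Sum>s<n. l s (y s))"
    using linear_of_first_coefficients[OF assms(1)] by blast
  have "(\<lambda>\<omega>. l s (x s \<omega>)) \<in> borel_measurable N" if "s < n" for s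
    using borel_measurable_continuous_onI[OF linear_continuous_on[OF l(1)]] x[OF that]
    by (rule measurable_compose_rev)
  then show ?thesis
    by (auto simp: l(2))
qed

lemma integrable_linear_of_first:
  fixes x :: "nat \<Rightarrow> 'w \<Rightarrow> 'a::euclidean_space"
  assumes "linear_of_first n L" and x: "\<And>s. s < n \<Longrightarrow> integrable N (x s)"
  shows "integrable N (\<lambda>\<omega>. L (\<lambda>s. x s \<omega>))"
proof -
  obtain l where l: "\<And>s. bounded_linear (l s)" "\<And>y. L y = (\<Sum>s<n. l s (y s))"
    using linear_of_first_coefficients[OF assms(1)] by blast
  show ?thesis
    using integrable_bounded_linear[OF l(1) x] by (auto simp: l(2))
qed

lemma linear_update_algorithmD:
  assumes "linear_update_algorithm A"
  shows "linear_of_first (Suc t) (query A t)" "linear_of_first (Suc (Suc t)) (update A t)"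
  using assms by (simp_all add: linear_update_algorithm_def)

section \<open>The average of the local runs as a single run\<close>

text \<open>The history at time \<open>t\<close> is determined by the answers given to machines
  below \<open>M\<close> before time \<open>t\<close>. This later permits replacing the full family
  of draws by a tuple that records only those before \<open>t\<close>.\<close>

lemma local_history_cong:
  assumes "\<And>m s. m < M \<Longrightarrow> s < t \<Longrightarrow> G m s = G' m s" and "m < M"
  shows "local_history A M K G t m = local_history A M K G' t m"
  using assms
proof (induction t arbitrary: m)
  case (Suc t)
  have "local_history A M K G t j = local_history A M K G' t j" if "j < M" for j
    using Suc.IH[of j] Suc.prems(1) that by simp
  then show ?case
    using Suc.prems by (auto simp: Let_def intro!: sum.cong)
qed simp

definition local_query ::
    "'a::real_vector algorithm \<Rightarrow> nat \<Rightarrow> nat \<Rightarrow> (nat \<Rightarrow> nat \<Rightarrow> 'a \<Rightarrow> 'a) \<Rightarrow> nat \<Rightarrow> nat \<Rightarrow> 'a" where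
  "local_query A M K G m t = query A t (local_history A M K G t m)"

text \<open>A vector and not a function of a query point: the answers are taken at different local
  points, so their mean is in general not an answer at the averaged point. It therefore enters
  \<open>history\<close> as a response that ignores its argument.\<close>

definition mean_gradient ::
    "'a::real_vector algorithm \<Rightarrow> nat \<Rightarrow> nat \<Rightarrow> (nat \<Rightarrow> nat \<Rightarrow> 'a \<Rightarrow> 'a) \<Rightarrow> nat \<Rightarrow> 'a" where
  "mean_gradient A M K G t = (1 / real M) *\<^sub>R (\<Sum>m<M. G m t (local_query A M K G m t))"

text \<open>Linearity of \<open>query\<close> and \<open>update\<close> in the whole history lets
  averaging pass through every iteration. All entries are averaged, not just the last one, since
  later iterations may use any of them.\<close>

lemma history_mean_gradient:
  assumes A: "linear_update_algorithm A" and "M \<ge> 1"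
  shows "history A (\<lambda>t _. mean_gradient A M K G t) t
    = (\<lambda>s. (1 / real M) *\<^sub>R (\<Sum>m<M. local_history A M K G t m s))"
proof (induction t)
  case 0
  then show ?case
    using \<open>M \<ge> 1\<close> by (simp add: sum_constant_scaleR del: sum_constant)
next
  case (Suc t)
  define x where "x m = local_history A M K G t m" for m
  define y where "y m = step A t (x m) (G m t)" for m
  \<comment> \<open>The mean gradient in slot \<open>Suc t\<close> is the mean of the local answers
    in that slot, so the whole argument of \<open>update\<close> is a mean of local
    arguments.\<close>
  have "update A t ((\<lambda>s. (1 / real M) *\<^sub>R (\<Sum>m<M. x m s))(Suc t := mean_gradient A M K G t))
      = update A t (\<lambda>s. (1 / real M) *\<^sub>R (\<Sum>m<M. ((x m)(Suc t := G m t (query A t (x m)))) s))"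
    by (rule arg_cong[where f = "update A t"])
      (auto simp: mean_gradient_def local_query_def x_def)
  also have "\<dots> = (1 / real M) *\<^sub>R (\<Sum>m<M. y m)"
    unfolding linear_of_first_mean[OF linear_update_algorithmD(2)[OF A]]
    by (simp add: y_def step_def fun_upd_def)
  finally have upd: "update A t ((\<lambda>s. (1 / real M) *\<^sub>R (\<Sum>m<M. x m s))(Suc t := mean_gradient A M K G t))
      = (1 / real M) *\<^sub>R (\<Sum>m<M. y m)" .
  have loc: "local_history A M K G (Suc t) m
      = (x m)(Suc t := if K dvd Suc t then (1 / real M) *\<^sub>R (\<Sum>j<M. y j) else y m)" for m
    by (simp add: x_def y_def Let_def)
  show ?case
  proof
    \<comment> \<open>At the end of a round each machine holds the mean of the \<open>y m\<close>,
      and a mean of \<open>M\<close> equal vectors is that vector; both cases leave the same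
      average.\<close>
    fix s
    show "history A (\<lambda>t _. mean_gradient A M K G t) (Suc t) s
        = (1 / real M) *\<^sub>R (\<Sum>m<M. local_history A M K G (Suc t) m s)"
      unfolding loc history.simps Suc.IH step_def
      using upd \<open>M \<ge> 1\<close>
      by (cases "K dvd Suc t") (auto simp: x_def sum_constant_scaleR simp del: sum_constant)
  qed
qed

lemma averaged_iterate_eq_iterate:
  assumes "linear_update_algorithm A" and "M \<ge> 1"
  shows "averaged_iterate A M K G t = iterate A (\<lambda>t _. mean_gradient A M K G t) t"
  using history_mean_gradient[OF assms, of K G t]
  by (simp add: averaged_iterate_def local_iterate_def iterate_def)

lemma query_point_mean_gradient:
  assumes "linear_update_algorithm A" and "M \<ge> 1"
  shows "query_point A (\<lambda>t _. mean_gradient A M K G t) t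
    = (1 / real M) *\<^sub>R (\<Sum>m<M. local_query A M K G m t)"
  unfolding query_point_def history_mean_gradient[OF assms] local_query_def
  by (rule linear_of_first_mean[OF linear_update_algorithmD(1)[OF assms(1)]])

section \<open>Integrability and measurability along a run\<close>

text \<open>Each new entry is a linear function of earlier entries and one gradient. Entries
  \<open>s > t\<close> still equal the constant \<open>init A\<close>, so the claim covers every
  \<open>s\<close>.\<close>

lemma integrable_history:
  fixes A :: "'a::euclidean_space algorithm"
  assumes A: "linear_update_algorithm A" and "finite_measure P"
    and h: "\<And>s. s < t \<Longrightarrow> integrable P (h s)"
  shows "integrable P (\<lambda>\<omega>. history A (\<lambda>t _. h t \<omega>) t s)"
  using h
proof (induction t arbitrary: s)
  case 0
  interpret finite_measure P by fact
  show ?case by simp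
next
  case (Suc t)
  have IH: "integrable P (\<lambda>\<omega>. history A (\<lambda>t _. h t \<omega>) t r)" for r
    using Suc by simp
  have "integrable P (\<lambda>\<omega>. update A t (\<lambda>r. if r = Suc t then h t \<omega> else history A (\<lambda>t _. h t \<omega>) t r))"
  proof (rule integrable_linear_of_first[OF linear_update_algorithmD(2)[OF A]])
    show "integrable P (\<lambda>\<omega>. if r = Suc t then h t \<omega> else history A (\<lambda>t _. h t \<omega>) t r)" for r
      using IH Suc.prems by (cases "r = Suc t") auto
  qed
  then show ?case
    using IH by (cases "s = Suc t") (auto simp: step_def fun_upd_def)
qed

lemma integrable_query_point:
  fixes A :: "'a::euclidean_space algorithm"
  assumes A: "linear_update_algorithm A" and "finite_measure P"
    and "\<And>s. s < t \<Longrightarrow> integrable P (h s)"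
  shows "integrable P (\<lambda>\<omega>. query_point A (\<lambda>t _. h t \<omega>) t)"
  unfolding query_point_def
  by (intro integrable_linear_of_first[OF linear_update_algorithmD(1)[OF A]]
      integrable_history assms)

text \<open>Here \<open>y\<close> is a tuple of draws indexed by machine and iteration, and the
  history becomes a deterministic function of it. Query point and draw both depend on
  \<open>y\<close>, hence the use of joint measurability of \<open>g\<close>. The set
  \<open>J\<close> may contain later indices, so that the same history can be viewed from a later
  past.\<close>

lemma borel_measurable_local_history:
  fixes A :: "'a::euclidean_space algorithm"
  assumes A: "linear_update_algorithm A"
    and g: "(\<lambda>(x, \<zeta>). g x \<zeta>) \<in> borel_measurable (borel \<Otimes>\<^sub>M Z)"
    and "{..<M} \<times> {..<t} \<subseteq> J" and "m < M"
  shows "(\<lambda>y. local_history A M K (\<lambda>m t x. g x (y (m, t))) t m s)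
    \<in> borel_measurable (PiM J (\<lambda>_. Z))"
  using assms(3,4)
proof (induction t arbitrary: m s)
  case (Suc t)
  define G where "G y = (\<lambda>m t x. g x (y (m, t)))" for y :: "nat \<times> nat \<Rightarrow> _"
  have IH: "(\<lambda>y. local_history A M K (G y) t j r) \<in> borel_measurable (PiM J (\<lambda>_. Z))"
    if "j < M" for j r
    unfolding G_def by (rule Suc.IH) (use Suc.prems that in auto)
  have "(\<lambda>y. g (local_query A M K (G y) j t) (y (j, t))) \<in> borel_measurable (PiM J (\<lambda>_. Z))"
    if "j < M" for j
  proof -
    have "(\<lambda>y. local_query A M K (G y) j t) \<in> borel_measurable (PiM J (\<lambda>_. Z))"
      unfolding local_query_def
      by (intro borel_measurable_linear_of_first[OF linear_update_algorithmD(1)[OF A]] IH that)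
    moreover have "(\<lambda>y. y (j, t)) \<in> measurable (PiM J (\<lambda>_. Z)) Z"
      by (rule measurable_component_singleton) (use Suc.prems that in auto)
    ultimately show ?thesis
      using measurable_compose[OF measurable_Pair g] by simp
  qed
  then have answer: "(\<lambda>y. G y j t (query A t (local_history A M K (G y) t j)))
      \<in> borel_measurable (PiM J (\<lambda>_. Z))" if "j < M" for j
    using that by (simp add: G_def local_query_def)
  have "(\<lambda>y. step A t (local_history A M K (G y) t j) (G y j t))
      \<in> borel_measurable (PiM J (\<lambda>_. Z))" if "j < M" for j
    unfolding step_def fun_upd_def
  proof (rule borel_measurable_linear_of_first[OF linear_update_algorithmD(2)[OF A]])
    show "(\<lambda>y. if s = Suc t then G y j t (query A t (local_history A M K (G y) t j))
        else local_history A M K (G y) t j s) \<in> borel_measurable (PiM J (\<lambda>_. Z))" for s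
      using answer IH that by (cases "s = Suc t") auto
  qed
  then show ?case
    using IH Suc.prems by (auto simp: G_def Let_def)
qed simp

lemma borel_measurable_local_query:
  fixes A :: "'a::euclidean_space algorithm"
  assumes A: "linear_update_algorithm A"
    and g: "(\<lambda>(x, \<zeta>). g x \<zeta>) \<in> borel_measurable (borel \<Otimes>\<^sub>M Z)"
    and "{..<M} \<times> {..<t} \<subseteq> J" and "m < M"
  shows "(\<lambda>y. local_query A M K (\<lambda>m t x. g x (y (m, t))) m t) \<in> borel_measurable (PiM J (\<lambda>_. Z))"
  unfolding local_query_def
  by (intro borel_measurable_linear_of_first[OF linear_update_algorithmD(1)[OF A]]
      borel_measurable_local_history assms)

section \<open>Gradients of quadratic functions\<close>

lemma gradient_quadratic:
  fixes F :: "real ^ 'n \<Rightarrow> real"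
  assumes "quadratic F"
  obtains S b where "\<And>x. gradient F x = S *v x + b"
proof -
  obtain Q b c where F: "F = (\<lambda>x. 1 / 2 * (x \<bullet> (Q *v x)) + b \<bullet> x + c)"
    using assms unfolding quadratic_def by blast
  \<comment> \<open>\<open>Q\<close> need not be symmetric; the gradient of the quadratic form is
    given by its symmetric part.\<close>
  define S where "S = (1 / 2) *\<^sub>R (Q + transpose Q)"
  have sym: "h \<bullet> (transpose Q *v x) = x \<bullet> (Q *v h)" for x h
    by (metis dot_lmul_matrix inner_commute transpose_matrix_vector)
  have "GDERIV F x :> S *v x + b" for x
    unfolding gderiv_def F
    by (rule has_derivative_eq_rhs)
      (auto intro!: derivative_eq_intros bounded_linear.has_derivative[OF matrix_vector_mul_bounded_linear]
        simp: fun_eq_iff S_def inner_add_right scaleR_matrix_vector_assoc[symmetric]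
        matrix_vector_mult_add_rdistrib sym inner_commute algebra_simps
        simp del: transpose_matrix_vector)
  moreover have "D = D'" if "GDERIV F x :> D" "GDERIV F x :> D'" for x D D'
    using has_derivative_unique[OF that[unfolded gderiv_def]]
    by (metis inner_commute vector_eq_ldot)
  ultimately have "gradient F x = S *v x + b" for x
    unfolding gradient_def by blast
  then show thesis by (rule that)
qed

text \<open>The gradient is affine and the weights \<open>1 / real M\<close> sum to one. This
  identifies the mean of the gradients at the local query points with the gradient at the averaged
  query point.\<close>

lemma gradient_quadratic_mean:
  fixes F :: "real ^ 'n \<Rightarrow> real"
  assumes "quadratic F" and "M \<ge> 1"
  shows "gradient F ((1 / real M) *\<^sub>R (\<Sum>m<M. x m)) = (1 / real M) *\<^sub>R (\<Sum>m<M. gradient F (x m))"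
proof -
  obtain S b where grad: "\<And>x. gradient F x = S *v x + b"
    using gradient_quadratic[OF assms(1)] by blast
  show ?thesis
    using \<open>M \<ge> 1\<close>
    by (simp add: grad sum.distrib scaleR_add_right matrix_vector_mult_scaleR
        vec.linear_sum[OF matrix_vector_mul_linear_gen] linear_sum[OF matrix_vector_mul_linear]
        sum_constant_scaleR del: sum_constant)
qed

section \<open>Independence and conditional expectation\<close>

lemma (in finite_measure) integrable_if_integrable_norm_square:
  fixes f :: "'a \<Rightarrow> 'b::{banach, second_countable_topology}"
  assumes "f \<in> borel_measurable M" and "integrable M (\<lambda>x. (norm (f x))\<^sup>2)"
  shows "integrable M f"
proof (rule Bochner_Integration.integrable_bound)
  show "integrable M (\<lambda>x. 1 + (norm (f x))\<^sup>2)" using assms(2) by simp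
  have "norm v \<le> 1 + (norm v)\<^sup>2" for v :: 'b
    using zero_le_power2[of "norm v - 1 / 2"] by (simp add: power2_eq_square algebra_simps)
  then show "AE x in M. norm (f x) \<le> norm (1 + (norm (f x))\<^sup>2)"
    by (simp add: order.trans[OF _ abs_ge_self])
qed (rule assms(1))

text \<open>Under independence the joint law is a product, so by Tonelli the bound \<open>c\<close>
  for each frozen \<open>y\<close> integrates to at most \<open>c\<close> over the law of
  \<open>Y\<close>. It transfers variance bounds from fixed to random query points.\<close>

lemma (in prob_space) indep_var_integrable_pair:
  fixes \<phi> :: "'b \<Rightarrow> 'b \<Rightarrow> real"
  assumes ind: "indep_var N Y L W"
    and \<phi>[measurable]: "case_prod \<phi> \<in> borel_measurable (N \<Otimes>\<^sub>M L)"
    and nonneg: "\<And>y w. 0 \<le> \<phi> y w"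
    and int: "\<And>y. y \<in> space N \<Longrightarrow> integrable M (\<lambda>\<omega>. \<phi> y (W \<omega>))"
    and le: "\<And>y. y \<in> space N \<Longrightarrow> expectation (\<lambda>\<omega>. \<phi> y (W \<omega>)) \<le> c"
  shows "integrable M (\<lambda>\<omega>. \<phi> (Y \<omega>) (W \<omega>))"
proof (rule integrableI_nonneg)
  have [measurable]: "random_variable N Y" "random_variable L W"
    and dist: "distr M N Y \<Otimes>\<^sub>M distr M L W = distr M (N \<Otimes>\<^sub>M L) (\<lambda>\<omega>. (Y \<omega>, W \<omega>))"
    using ind unfolding indep_var_distribution_eq by auto
  interpret W: prob_space "distr M L W" by (rule prob_space_distr) measurable
  interpret Y: prob_space "distr M N Y" by (rule prob_space_distr) measurable
  show "(\<lambda>\<omega>. \<phi> (Y \<omega>) (W \<omega>)) \<in> borel_measurable M" by measurable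
  have "(\<integral>\<^sup>+\<omega>. \<phi> (Y \<omega>) (W \<omega>) \<partial>M)
      = (\<integral>\<^sup>+p. ennreal (case_prod \<phi> p) \<partial>(distr M N Y \<Otimes>\<^sub>M distr M L W))"
    by (simp add: dist nn_integral_distr)
  also have "\<dots> = (\<integral>\<^sup>+y. \<integral>\<^sup>+w. \<phi> y w \<partial>distr M L W \<partial>distr M N Y)"
    by (subst W.nn_integral_fst[symmetric]) simp_all
  also have "\<dots> \<le> (\<integral>\<^sup>+y. ennreal c \<partial>distr M N Y)"
  proof (rule nn_integral_mono)
    fix y assume "y \<in> space (distr M N Y)"
    then have [simp]: "y \<in> space N" by simp
    have [measurable]: "\<phi> y \<in> borel_measurable L"
      using measurable_compose[OF measurable_Pair1' \<phi>, of y] by simp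
    have "(\<integral>\<^sup>+w. \<phi> y w \<partial>distr M L W) = (\<integral>\<^sup>+\<omega>. \<phi> y (W \<omega>) \<partial>M)"
      by (simp add: nn_integral_distr)
    also have "\<dots> = ennreal (expectation (\<lambda>\<omega>. \<phi> y (W \<omega>)))"
      using int nonneg by (intro nn_integral_eq_integral) auto
    also have "\<dots> \<le> ennreal c" using le by (intro ennreal_leI) auto
    finally show "(\<integral>\<^sup>+w. \<phi> y w \<partial>distr M L W) \<le> ennreal c" .
  qed
  also have "\<dots> = ennreal c"
    using Y.emeasure_space_1 by simp
  also have "\<dots> < \<infinity>" by simp
  finally show "(\<integral>\<^sup>+\<omega>. \<phi> (Y \<omega>) (W \<omega>) \<partial>M) < \<infinity>" .
qed (use nonneg in simp)

text \<open>The freezing lemma: given \<open>Y\<close>, its value may be held fixed while the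
  independent \<open>W\<close> is averaged out. The proof tests both sides on the events generated
  by \<open>Y\<close> and applies Fubini to the product law.\<close>

lemma (in prob_space) real_cond_exp_indep_var:
  fixes \<phi> :: "'b \<Rightarrow> 'b \<Rightarrow> real"
  assumes ind: "indep_var N Y L W"
    and \<phi>[measurable]: "case_prod \<phi> \<in> borel_measurable (N \<Otimes>\<^sub>M L)"
    and int: "integrable M (\<lambda>\<omega>. \<phi> (Y \<omega>) (W \<omega>))"
  shows "AE \<omega> in M. real_cond_exp M (vimage_algebra (space M) Y N) (\<lambda>\<omega>. \<phi> (Y \<omega>) (W \<omega>)) \<omega>
    = expectation (\<lambda>\<omega>'. \<phi> (Y \<omega>) (W \<omega>'))"
proof -
  let ?F = "vimage_algebra (space M) Y N"
  have [measurable]: "random_variable N Y" "random_variable L W"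
    and dist: "distr M N Y \<Otimes>\<^sub>M distr M L W = distr M (N \<Otimes>\<^sub>M L) (\<lambda>\<omega>. (Y \<omega>, W \<omega>))"
    using ind unfolding indep_var_distribution_eq by auto
  have Y_space: "Y \<in> space M \<rightarrow> space N"
    using measurable_space[of Y M N] by auto
  then have YF: "Y \<in> measurable ?F N"
    by (rule measurable_vimage_algebra1)
  interpret W: prob_space "distr M L W" by (rule prob_space_distr) measurable
  interpret Y: prob_space "distr M N Y" by (rule prob_space_distr) measurable
  interpret YW: pair_prob_space "distr M N Y" "distr M L W" ..
  have "subalgebra M ?F"
    unfolding subalgebra_def using sets_image_in_sets[of M "space M" Y N] by simp
  then interpret finite_measure_subalgebra M ?F
    by unfold_locales
  \<comment> \<open>Integrating against the law of \<open>W\<close> makes measurability in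
    \<open>y\<close> part of Fubini. The rewriting as an expectation over \<open>M\<close> is made
    on \<open>space N\<close> only, which contains all values of \<open>Y\<close>.\<close>
  define \<psi> where "\<psi> y = (\<integral>w. \<phi> y w \<partial>distr M L W)" for y
  have \<psi>[measurable]: "\<psi> \<in> borel_measurable N"
    unfolding \<psi>_def using W.borel_measurable_lebesgue_integral[of "\<phi>" N] by simp
  have \<psi>_eq: "\<psi> y = expectation (\<lambda>\<omega>. \<phi> y (W \<omega>))" if "y \<in> space N" for y
  proof -
    have [measurable]: "\<phi> y \<in> borel_measurable L"
      using measurable_compose[OF measurable_Pair1' \<phi>, of y] that by simp
    show ?thesis unfolding \<psi>_def by (simp add: integral_distr)
  qed
  have intp: "integrable (distr M N Y \<Otimes>\<^sub>M distr M L W) (case_prod \<phi>)"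
    using int by (simp add: dist integrable_distr_eq)
  have "integrable (distr M N Y) \<psi>"
    unfolding \<psi>_def using YW.integrable_fst'[OF intp] by simp
  then have int\<psi>: "integrable M (\<lambda>\<omega>. \<psi> (Y \<omega>))"
    by (simp add: integrable_distr_eq)
  have "AE \<omega> in M. real_cond_exp M ?F (\<lambda>\<omega>. \<phi> (Y \<omega>) (W \<omega>)) \<omega> = \<psi> (Y \<omega>)"
  proof (rule real_cond_exp_charact)
    fix A assume "A \<in> sets ?F"
    then obtain B where B[measurable]: "B \<in> sets N" and A: "A = Y -` B \<inter> space M"
      by (subst (asm) sets_vimage_algebra2[OF Y_space]) auto
    \<comment> \<open>Every event generated by \<open>Y\<close> has the form that \<open>Y\<close>
      lies in \<open>B\<close>, so testing on it amounts to weighting \<open>\<phi>\<close> by the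
      indicator of \<open>B\<close> in the first coordinate.\<close>
    define u where "u = (\<lambda>(y, w). indicat_real B y * \<phi> y w)"
    have [measurable]: "u \<in> borel_measurable (N \<Otimes>\<^sub>M L)" unfolding u_def by measurable
    have "integrable (distr M N Y \<Otimes>\<^sub>M distr M L W) u"
      by (rule Bochner_Integration.integrable_bound[OF intp]) (auto simp: u_def split: split_indicator)
    then have "(\<integral>y. \<integral>w. u (y, w) \<partial>distr M L W \<partial>distr M N Y)
        = integral\<^sup>L (distr M N Y \<Otimes>\<^sub>M distr M L W) u"
      by (rule YW.integral_fst')
    then have "(\<integral>y. indicat_real B y * \<psi> y \<partial>distr M N Y)
        = (\<integral>\<omega>. indicat_real B (Y \<omega>) * \<phi> (Y \<omega>) (W \<omega>) \<partial>M)"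
      by (simp add: u_def \<psi>_def dist integral_distr)
    then have "(\<integral>\<omega>. indicat_real B (Y \<omega>) * \<phi> (Y \<omega>) (W \<omega>) \<partial>M)
        = (\<integral>\<omega>. indicat_real B (Y \<omega>) * \<psi> (Y \<omega>) \<partial>M)"
      by (simp add: integral_distr)
    moreover have "indicat_real A \<omega> = indicat_real B (Y \<omega>)" if "\<omega> \<in> space M" for \<omega>
      using that by (simp add: A indicator_def)
    ultimately show "(\<integral>\<omega>\<in>A. \<phi> (Y \<omega>) (W \<omega>) \<partial>M) = (\<integral>\<omega>\<in>A. \<psi> (Y \<omega>) \<partial>M)"
      unfolding set_lebesgue_integral_def by (simp cong: Bochner_Integration.integral_cong)
  qed (use int int\<psi> measurable_compose[OF YF \<psi>] in auto)
  with AE_space show ?thesis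
    by eventually_elim (use Y_space in \<open>simp add: \<psi>_eq Pi_iff\<close>)
qed

text \<open>Variances of independent centred vectors add: when the squared norm of the sum is
  expanded, the off-diagonal inner products have expectation zero.\<close>

lemma (in prob_space) norm_sum_indep_vars:
  fixes X :: "'i \<Rightarrow> 'a \<Rightarrow> 'b::euclidean_space"
  assumes ind: "indep_vars (\<lambda>_. borel) X I" and "finite I"
    and sq: "\<And>i. i \<in> I \<Longrightarrow> integrable M (\<lambda>\<omega>. (norm (X i \<omega>))\<^sup>2)"
    and zero: "\<And>i. i \<in> I \<Longrightarrow> expectation (X i) = 0"
  shows "integrable M (\<lambda>\<omega>. (norm (\<Sum>i\<in>I. X i \<omega>))\<^sup>2)"
    and "expectation (\<lambda>\<omega>. (norm (\<Sum>i\<in>I. X i \<omega>))\<^sup>2) = (\<Sum>i\<in>I. expectation (\<lambda>\<omega>. (norm (X i \<omega>))\<^sup>2))"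
proof -
  have meas: "random_variable borel (X i)" if "i \<in> I" for i
    using ind that by (auto simp: indep_vars_def)
  have intX: "integrable M (X i)" if "i \<in> I" for i
    using integrable_if_integrable_norm_square[OF meas sq] that by simp
  have off: "integrable M (\<lambda>\<omega>. X i \<omega> \<bullet> X j \<omega>) \<and> expectation (\<lambda>\<omega>. X i \<omega> \<bullet> X j \<omega>) = 0"
    if "i \<in> I" "j \<in> I" "i \<noteq> j" for i j
  proof -
    have ij: "indep_var borel (X i) borel (X j)"
      using indep_var_compose[OF indep_var_restrict[OF ind, of "{i}" "{j}"],
          of "\<lambda>w. w i" borel "\<lambda>w. w j" borel] that
      by (simp add: comp_def)
    \<comment> \<open>The product rule for expectations concerns real variables, so the inner
      product is split into coordinates \<open>b\<close>.\<close>
    have b: "indep_var borel (\<lambda>\<omega>. X i \<omega> \<bullet> b) borel (\<lambda>\<omega>. X j \<omega> \<bullet> b)" for b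
      using indep_var_compose[OF ij, of "\<lambda>v. v \<bullet> b" borel "\<lambda>v. v \<bullet> b" borel] by (simp add: comp_def)
    have int: "integrable M (\<lambda>\<omega>. X i \<omega> \<bullet> b)" "integrable M (\<lambda>\<omega>. X j \<omega> \<bullet> b)" for b
      using intX that by auto
    have "expectation (\<lambda>\<omega>. (X i \<omega> \<bullet> b) * (X j \<omega> \<bullet> b)) = 0" for b
      unfolding indep_var_lebesgue_integral[OF b int]
      using intX that zero by simp
    then show ?thesis
      using indep_var_integrable[OF b int] by (subst (1 2) euclidean_inner) simp
  qed
  have int: "integrable M (\<lambda>\<omega>. X i \<omega> \<bullet> X j \<omega>)" if "i \<in> I" "j \<in> I" for i j
    using off[OF that] sq[OF that(1)] by (cases "i = j") (auto simp: dot_square_norm)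
  have eq: "(norm (\<Sum>i\<in>I. X i \<omega>))\<^sup>2 = (\<Sum>i\<in>I. \<Sum>j\<in>I. X i \<omega> \<bullet> X j \<omega>)" for \<omega>
    by (simp add: inner_sum_left inner_sum_right flip: dot_square_norm)
      (rule sum.swap)
  show "integrable M (\<lambda>\<omega>. (norm (\<Sum>i\<in>I. X i \<omega>))\<^sup>2)"
    unfolding eq using int by auto
  have "expectation (\<lambda>\<omega>. (norm (\<Sum>i\<in>I. X i \<omega>))\<^sup>2)
      = (\<Sum>i\<in>I. \<Sum>j\<in>I. expectation (\<lambda>\<omega>. X i \<omega> \<bullet> X j \<omega>))"
    unfolding eq using int by (simp add: Bochner_Integration.integral_sum)
  also have "\<dots> = (\<Sum>i\<in>I. \<Sum>j\<in>I. if j = i then expectation (\<lambda>\<omega>. (norm (X i \<omega>))\<^sup>2) else 0)"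
    using off by (intro sum.cong refl) (auto simp: dot_square_norm)
  finally show "expectation (\<lambda>\<omega>. (norm (\<Sum>i\<in>I. X i \<omega>))\<^sup>2)
      = (\<Sum>i\<in>I. expectation (\<lambda>\<omega>. (norm (X i \<omega>))\<^sup>2))"
    using \<open>finite I\<close> by simp
qed

section \<open>The mean of the local stochastic gradients\<close>

lemma stochastic_gradientsD:
  assumes "stochastic_gradients P Z F v M T g z" and "m < M" and "t < T"
  shows "integrable P (\<lambda>\<omega>. g x (z m t \<omega>))"
    and "prob_space.expectation P (\<lambda>\<omega>. g x (z m t \<omega>)) = gradient F x"
    and "integrable P (\<lambda>\<omega>. (norm (g x (z m t \<omega>) - gradient F x))\<^sup>2)"
    and "prob_space.expectation P (\<lambda>\<omega>. (norm (g x (z m t \<omega>) - gradient F x))\<^sup>2) \<le> v"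
  using assms by (simp_all add: stochastic_gradients_def)

text \<open>The query points \<open>x m\<close> are deterministic here; the random ones are handled
  by freezing the past. The \<open>M\<close> deviations are independent and centred, so their sum
  has variance at most \<open>M * v\<close>, and the factor \<open>1 / real M\<close> enters
  squared.\<close>

lemma mean_stochastic_gradient_variance:
  fixes F :: "real ^ 'n \<Rightarrow> real" and x :: "nat \<Rightarrow> real ^ 'n"
  assumes sg: "stochastic_gradients P Z F v M T g z" and "M \<ge> 1" and t: "t < T"
  defines "dev \<equiv> \<lambda>\<omega>. (1 / real M) *\<^sub>R (\<Sum>m<M. g (x m) (z m t \<omega>) - gradient F (x m))"
  shows "integrable P (\<lambda>\<omega>. (norm (dev \<omega>))\<^sup>2)"
    and "prob_space.expectation P (\<lambda>\<omega>. (norm (dev \<omega>))\<^sup>2) \<le> v / real M"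
proof -
  interpret prob_space P using sg by (simp add: stochastic_gradients_def)
  define X where "X m \<omega> = g (x m) (z m t \<omega>) - gradient F (x m)" for m \<omega>
  have g[measurable]: "(\<lambda>(x, \<zeta>). g x \<zeta>) \<in> borel_measurable (borel \<Otimes>\<^sub>M Z)"
    and ind: "indep_vars (\<lambda>_. Z) (\<lambda>(m, t). z m t) ({..<M} \<times> {..<T})"
    using sg by (simp_all add: stochastic_gradients_def)
  have gx[measurable]: "g y \<in> borel_measurable Z" for y
    using measurable_compose[OF measurable_Pair1' g, of y] by simp
  \<comment> \<open>Grouping the draws into the singleton blocks \<open>{(m, t)}\<close> extracts
    independence across machines within the one iteration \<open>t\<close>.\<close>
  have "indep_vars (\<lambda>m. PiM {(m, t)} (\<lambda>_. Z)) (\<lambda>m \<omega>. \<lambda>i\<in>{(m, t)}. (case i of (m, t) \<Rightarrow> z m t) \<omega>) {..<M}"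
    by (rule indep_vars_restrict[OF ind]) (use t in \<open>auto simp: disjoint_family_on_def\<close>)
  from indep_vars_compose2[OF this, where Y = "\<lambda>m w. g (x m) (w (m, t)) - gradient F (x m)"
      and N = "\<lambda>_. borel"]
  have indX: "indep_vars (\<lambda>_. borel) X {..<M}"
    by (simp add: X_def[abs_def])
  have X: "integrable P (\<lambda>\<omega>. (norm (X m \<omega>))\<^sup>2)" "expectation (X m) = 0"
    "expectation (\<lambda>\<omega>. (norm (X m \<omega>))\<^sup>2) \<le> v" if "m < M" for m
    using stochastic_gradientsD[OF sg that t, of "x m"]
    by (simp_all add: X_def[abs_def] prob_space)
  have eq: "(norm (dev \<omega>))\<^sup>2 = (norm (\<Sum>m<M. X m \<omega>))\<^sup>2 / (real M)\<^sup>2" for \<omega>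
    by (simp add: dev_def X_def power_divide)
  note sum = norm_sum_indep_vars[OF indX]
  show "integrable P (\<lambda>\<omega>. (norm (dev \<omega>))\<^sup>2)"
    unfolding eq using sum(1) X by simp
  have "expectation (\<lambda>\<omega>. (norm (dev \<omega>))\<^sup>2) = (\<Sum>m<M. expectation (\<lambda>\<omega>. (norm (X m \<omega>))\<^sup>2)) / (real M)\<^sup>2"
    unfolding eq using sum(2) X by simp
  also have "\<dots> \<le> (\<Sum>m<M. v) / (real M)\<^sup>2"
    by (intro divide_right_mono sum_mono) (use X in auto)
  also have "\<dots> = v / real M"
    using \<open>M \<ge> 1\<close> by (simp add: power2_eq_square)
  finally show "expectation (\<lambda>\<omega>. (norm (dev \<omega>))\<^sup>2) \<le> v / real M" .
qed

text \<open>The past before iteration \<open>t\<close> is generated by the draws of all machines in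
  earlier iterations. All local query points are functions of these, while the draws of iteration
  \<open>t\<close> are independent of them, so the freezing lemma reduces conditional mean and
  variance to fixed query points.\<close>

lemma mean_gradient_conditionally_unbiased_run:
  fixes A :: "(real ^ 'n) algorithm" and F :: "real ^ 'n \<Rightarrow> real"
  assumes A: "linear_update_algorithm A" and "M \<ge> 1" and F: "quadratic F"
    and sg: "stochastic_gradients P Z F v M T g z"
  obtains \<F> where "conditionally_unbiased_run P \<F> A F (v / real M) T
    (\<lambda>t \<omega>. mean_gradient A M K (\<lambda>m t y. g y (z m t \<omega>)) t)"
proof -
  interpret prob_space P using sg by (simp add: stochastic_gradients_def)
  have g: "(\<lambda>(x, \<zeta>). g x \<zeta>) \<in> borel_measurable (borel \<Otimes>\<^sub>M Z)"
    and ind: "indep_vars (\<lambda>_. Z) (\<lambda>(m, t). z m t) ({..<M} \<times> {..<T})"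
    using sg by (simp_all add: stochastic_gradients_def)
  define h where "h t \<omega> = mean_gradient A M K (\<lambda>m t y. g y (z m t \<omega>)) t" for t \<omega>
  \<comment> \<open>Cut off at \<open>T\<close>, since later draws need not be measurable.\<close>
  define J where "J t = {..<M} \<times> {..<min t T}" for t
  define N where "N t = PiM (J t) (\<lambda>_. Z)" for t
  define Y where "Y t \<omega> = (\<lambda>i\<in>J t. case_prod z i \<omega>)" for t \<omega>
  define \<F> where "\<F> t = vimage_algebra (space P) (Y t) (N t)" for t
  have zZ: "z m t \<in> measurable P Z" if "m < M" "t < T" for m t
    using ind that unfolding indep_vars_def by force
  have YP: "Y t \<in> measurable P (N t)" for t
    unfolding Y_def N_def by (rule measurable_restrict) (auto simp: J_def intro!: zZ)
  have YF: "Y t \<in> measurable (\<F> t) (N t)" for t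
    unfolding \<F>_def by (rule measurable_vimage_algebra1) (use measurable_space[OF YP] in auto)
  have space_F: "space (\<F> t) = space P" for t
    by (simp add: \<F>_def)
  have sub: "subalgebra P (\<F> t)" for t
    unfolding subalgebra_def space_F unfolding \<F>_def using sets_image_in_sets[OF refl YP] by simp
  have "filtration (space P) \<F>"
  proof
    fix s t :: nat assume "s \<le> t"
    then have "J s \<subseteq> J t" by (auto simp: J_def)
    then have "Y s = (\<lambda>y. restrict y (J s)) \<circ> Y t"
      by (auto simp: Y_def fun_eq_iff)
    moreover have "(\<lambda>y. restrict y (J s)) \<in> measurable (N t) (N s)"
      unfolding N_def by (rule measurable_restrict_subset) fact
    ultimately have "Y s \<in> measurable (\<F> t) (N s)"
      using measurable_comp[OF YF] by metis
    then show "sets (\<F> s) \<le> sets (\<F> t)"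
      unfolding \<F>_def[of s] by (rule sets_image_in_sets[OF space_F])
  qed (rule space_F)

  \<comment> \<open>The local query point as a function of a tuple of draws. Evaluated at
    \<open>Y s\<close> it gives the actual query point for any \<open>s \<ge> t\<close>;
    \<open>s = t\<close> serves for conditioning, \<open>s = Suc t\<close> for adaptedness.\<close>
  define q where "q t m y = local_query A M K (\<lambda>m t x. g x (y (m, t))) m t"
    for t m and y :: "nat \<times> nat \<Rightarrow> _"
  have q_meas: "q t m \<in> borel_measurable (N s)" if "m < M" "t \<le> T" "t \<le> s" for t s m
    unfolding q_def N_def by (rule borel_measurable_local_query[OF A g])
      (use that in \<open>auto simp: J_def\<close>)
  have q_Y: "q t m (Y s \<omega>) = local_query A M K (\<lambda>m t y. g y (z m t \<omega>)) m t"
    if "m < M" "t \<le> T" "t \<le> s" for t s m \<omega>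
    unfolding q_def local_query_def
    by (rule arg_cong[OF local_history_cong]) (use that in \<open>auto simp: Y_def J_def\<close>)
  have comp_meas: "(\<lambda>a. g (u a) (w a)) \<in> borel_measurable S"
    if "u \<in> borel_measurable S" "w \<in> measurable S Z" for u w and S :: "'s measure"
    using measurable_compose[OF measurable_Pair[OF that] g] by simp
  define qbar where "qbar t \<omega> = query_point A (\<lambda>s _. h s \<omega>) t" for t \<omega>
  have grad_qbar: "gradient F (qbar t \<omega>) = (1 / real M) *\<^sub>R (\<Sum>m<M. gradient F (q t m (Y t \<omega>)))"
    if "t < T" for t \<omega>
    using that by (simp add: qbar_def h_def query_point_mean_gradient[OF A \<open>M \<ge> 1\<close>] q_Y
        gradient_quadratic_mean[OF F \<open>M \<ge> 1\<close>])
  obtain S b where grad: "\<And>x. gradient F x = S *v x + b"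
    using gradient_quadratic[OF F] by blast
  have gradF_meas: "gradient F \<in> borel_measurable borel"
    unfolding grad by (intro borel_measurable_continuous_onI continuous_intros linear_continuous_on) auto

  \<comment> \<open>The block of fresh draws of all machines in iteration \<open>t\<close>, disjoint
    from the indices in \<open>J t\<close> and hence independent of \<open>Y t\<close>.\<close>
  define L where "L t = PiM ({..<M} \<times> {t}) (\<lambda>_. Z)" for t :: nat
  define W where "W t \<omega> = (\<lambda>i\<in>{..<M} \<times> {t}. case_prod z i \<omega>)" for t \<omega>
  have YW: "indep_var (N t) (Y t) (L t) (W t)" if "t < T" for t
  proof -
    have "J t \<inter> {..<M} \<times> {t} = {}" "J t \<subseteq> {..<M} \<times> {..<T}" "{..<M} \<times> {t} \<subseteq> {..<M} \<times> {..<T}"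
      using that by (auto simp: J_def)
    from indep_var_restrict[OF ind this] show ?thesis
      by (simp add: N_def Y_def[abs_def] L_def W_def[abs_def] case_prod_beta')
  qed
  \<comment> \<open>The mean gradient and its deviation from the true gradient, written as functions
    of a frozen past \<open>y\<close> and fresh draws \<open>w\<close>.\<close>
  define answer where "answer t y w = (1 / real M) *\<^sub>R (\<Sum>m<M. g (q t m y) (w (m, t)))"
    for t y and w :: "nat \<times> nat \<Rightarrow> _"
  define dev where "dev t y w = (1 / real M) *\<^sub>R (\<Sum>m<M. g (q t m y) (w (m, t)) - gradient F (q t m y))"
    for t y and w :: "nat \<times> nat \<Rightarrow> _"
  have fst_q: "(\<lambda>p. q t m (fst p)) \<in> borel_measurable (N t \<Otimes>\<^sub>M L t)" if "m < M" "t < T" for t m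
    using q_meas[of m t t] that by (intro measurable_compose[OF measurable_fst]) auto
  have snd_w: "(\<lambda>p. snd p (m, t)) \<in> measurable (N t \<Otimes>\<^sub>M L t) Z" if "m < M" for t m
    unfolding L_def using that
    by (intro measurable_compose[OF measurable_snd measurable_component_singleton]) auto
  have answer_meas: "case_prod (answer t) \<in> borel_measurable (N t \<Otimes>\<^sub>M L t)" if "t < T" for t
    unfolding answer_def case_prod_beta'
    by (intro borel_measurable_scaleR borel_measurable_sum comp_meas fst_q snd_w) (use that in auto)
  have dev_meas: "case_prod (dev t) \<in> borel_measurable (N t \<Otimes>\<^sub>M L t)" if "t < T" for t
    unfolding dev_def case_prod_beta'
    by (intro borel_measurable_scaleR borel_measurable_sum borel_measurable_diff comp_meas
        fst_q snd_w measurable_compose[OF fst_q gradF_meas]) (use that in auto)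
  have h_eq: "h t \<omega> = answer t (Y t \<omega>) (W t \<omega>)" if "t < T" for t \<omega>
    using that by (simp add: h_def mean_gradient_def answer_def q_Y W_def)
  have dev_eq: "h t \<omega> - gradient F (qbar t \<omega>) = dev t (Y t \<omega>) (W t \<omega>)" if "t < T" for t \<omega>
    using that by (simp add: h_eq grad_qbar answer_def dev_def sum_subtractf scaleR_diff_right)
  have dev_var: "integrable P (\<lambda>\<omega>. (norm (dev t y (W t \<omega>)))\<^sup>2)"
    "expectation (\<lambda>\<omega>. (norm (dev t y (W t \<omega>)))\<^sup>2) \<le> v / real M" if "t < T" for t y
    using mean_stochastic_gradient_variance[OF sg \<open>M \<ge> 1\<close> that, of "\<lambda>m. q t m y"]
    by (simp_all add: dev_def W_def)
  have sq_meas: "(\<lambda>(y, w). (norm (dev t y w))\<^sup>2) \<in> borel_measurable (N t \<Otimes>\<^sub>M L t)" if "t < T" for t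
    using dev_meas[OF that] unfolding case_prod_beta' by measurable
  have dev_sq: "integrable P (\<lambda>\<omega>. (norm (dev t (Y t \<omega>) (W t \<omega>)))\<^sup>2)" if "t < T" for t
    by (rule indep_var_integrable_pair[OF YW sq_meas]) (use that dev_var in auto)
  have pair_meas: "(\<lambda>\<omega>. (Y t \<omega>, W t \<omega>)) \<in> measurable P (N t \<Otimes>\<^sub>M L t)" if "t < T" for t
    using YW[OF that] unfolding indep_var_distribution_eq by (intro measurable_Pair) auto
  have dev_int: "integrable P (\<lambda>\<omega>. dev t (Y t \<omega>) (W t \<omega>))" if "t < T" for t
  proof (rule integrable_if_integrable_norm_square)
    show "(\<lambda>\<omega>. dev t (Y t \<omega>) (W t \<omega>)) \<in> borel_measurable P"
      using measurable_compose[OF pair_meas dev_meas] that by simp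
  qed (rule dev_sq[OF that])
  \<comment> \<open>Integrability is assumed only at fixed points, whereas the query points are
    random. By induction the earlier mean gradients are integrable, hence so are the averaged query
    point and its affine image, the gradient; adding the square-integrable deviation gives
    \<open>h t\<close>.\<close>
  have h_int: "integrable P (h t)" if "t < T" for t
    using that
  proof (induction t rule: less_induct)
    case (less t)
    have "integrable P (qbar t)"
      unfolding qbar_def[abs_def]
      by (intro integrable_query_point[OF A] less.IH) (use less.prems finite_measure_axioms in auto)
    then have "integrable P (\<lambda>\<omega>. gradient F (qbar t \<omega>))"
      unfolding grad by (auto intro: integrable_bounded_linear[OF matrix_vector_mul_bounded_linear])
    then have "integrable P (\<lambda>\<omega>. dev t (Y t \<omega>) (W t \<omega>) + gradient F (qbar t \<omega>))"
      by (intro Bochner_Integration.integrable_add dev_int less.prems)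
    then show ?case
      by (simp add: dev_eq[OF less.prems, symmetric])
  qed
  \<comment> \<open>The answers of iteration \<open>t\<close> involve the draws
    \<open>(m, t)\<close>, which belong to \<open>J (Suc t)\<close> but not to
    \<open>J t\<close>.\<close>
  have h_meas: "h t \<in> borel_measurable (\<F> (Suc t))" if t: "t < T" for t
  proof -
    have answer_Suc: "(\<lambda>y. (1 / real M) *\<^sub>R (\<Sum>m<M. g (q t m y) (y (m, t)))) \<in> borel_measurable (N (Suc t))"
      by (intro borel_measurable_scaleR borel_measurable_sum comp_meas q_meas)
        (use that in \<open>auto simp: N_def J_def intro!: measurable_component_singleton\<close>)
    have "Y (Suc t) \<omega> (m, t) = z m t \<omega>" if "m < M" for m \<omega>
      using that t by (simp add: Y_def J_def)
    then have "h t \<omega> = (1 / real M) *\<^sub>R (\<Sum>m<M. g (q t m (Y (Suc t) \<omega>)) (Y (Suc t) \<omega> (m, t)))" for \<omega>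
      using t by (simp add: h_def mean_gradient_def q_Y)
    then have "h t = (\<lambda>\<omega>. (1 / real M) *\<^sub>R (\<Sum>m<M. g (q t m (Y (Suc t) \<omega>)) (Y (Suc t) \<omega> (m, t))))"
      by (rule ext)
    then show ?thesis
      using measurable_compose[OF YF answer_Suc] by simp
  qed
  have h_unbiased: "AE \<omega> in P. real_cond_exp P (\<F> t) (\<lambda>\<omega>. h t \<omega> $ i) \<omega> = gradient F (qbar t \<omega>) $ i"
    if t: "t < T" for t i
  proof -
    have "(\<lambda>(y, w). answer t y w $ i) \<in> borel_measurable (N t \<Otimes>\<^sub>M L t)"
      using measurable_compose[OF answer_meas[OF t]
          borel_measurable_continuous_onI[OF linear_continuous_on[OF bounded_linear_vec_nth]]]
      by (simp add: case_prod_beta')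
    moreover have "integrable P (\<lambda>\<omega>. answer t (Y t \<omega>) (W t \<omega>) $ i)"
      using integrable_bounded_linear[OF bounded_linear_vec_nth h_int[OF t], of i] by (simp add: h_eq[OF t])
    ultimately have "AE \<omega> in P. real_cond_exp P (\<F> t) (\<lambda>\<omega>. answer t (Y t \<omega>) (W t \<omega>) $ i) \<omega>
        = expectation (\<lambda>\<omega>'. answer t (Y t \<omega>) (W t \<omega>') $ i)"
      unfolding \<F>_def by (rule real_cond_exp_indep_var[OF YW[OF t]])
    \<comment> \<open>For frozen \<open>y\<close> each local answer is unbiased at its own query
      point; the mean of these gradients is the gradient at the averaged query point by
      \<open>grad_qbar\<close>.\<close>
    moreover have "expectation (\<lambda>\<omega>'. answer t y (W t \<omega>') $ i)
        = ((1 / real M) *\<^sub>R (\<Sum>m<M. gradient F (q t m y))) $ i" for y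
    proof -
      have int: "integrable P (\<lambda>\<omega>'. g (q t m y) (z m t \<omega>'))" if "m < M" for m
        using stochastic_gradientsD(1)[OF sg that t] .
      have "integrable P (\<lambda>\<omega>'. answer t y (W t \<omega>'))"
        by (auto simp: answer_def W_def intro!: integrable_scaleR_right Bochner_Integration.integrable_sum int)
      then have "expectation (\<lambda>\<omega>'. answer t y (W t \<omega>') $ i) = expectation (\<lambda>\<omega>'. answer t y (W t \<omega>')) $ i"
        by (rule integral_bounded_linear[OF bounded_linear_vec_nth])
      also have "expectation (\<lambda>\<omega>'. answer t y (W t \<omega>')) = (1 / real M) *\<^sub>R (\<Sum>m<M. gradient F (q t m y))"
        by (simp add: answer_def W_def int Bochner_Integration.integral_sum stochastic_gradientsD(2)[OF sg _ t])
      finally show ?thesis .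
    qed
    ultimately show ?thesis
      by (simp add: h_eq[OF t] grad_qbar[OF t])
  qed
  have h_var: "AE \<omega> in P. real_cond_exp P (\<F> t) (\<lambda>\<omega>. (norm (h t \<omega> - gradient F (qbar t \<omega>)))\<^sup>2) \<omega> \<le> v / real M"
    if t: "t < T" for t
    using real_cond_exp_indep_var[where \<phi> = "\<lambda>y w. (norm (dev t y w))\<^sup>2",
        OF YW[OF t] sq_meas[OF t] dev_sq[OF t]] dev_var(2)[OF t]
    unfolding \<F>_def dev_eq[OF t] by auto
  have "conditionally_unbiased_run P \<F> A F (v / real M) T h"
    unfolding conditionally_unbiased_run_def Let_def qbar_def[symmetric]
    using prob_space_axioms \<open>filtration (space P) \<F>\<close> sub h_meas h_int h_unbiased h_var dev_sq
    by (simp add: dev_eq)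
  then show thesis
    unfolding h_def by (rule that)
qed

section \<open>Transfer of the guarantees\<close>

text \<open>The averaged run lives on the same probability space \<open>P\<close>, so the guarantee
  for outcomes in \<open>'w\<close> applies to it with variance \<open>v / real M\<close>. The class
  \<open>C\<close> is left general to cover the convex and the strongly convex case at once.\<close>

lemma guarantees_averaged_iterate:
  fixes A :: "(real ^ 'n) algorithm" and P :: "'w measure"
  assumes "guarantees TYPE('w) A C \<epsilon>" and "linear_update_algorithm A"
    and "F \<in> C" and "quadratic F" and "M \<ge> 1" and "T \<ge> 1" and "v \<ge> 0"
    and "stochastic_gradients P Z F v M T g z"
  shows "prob_space.expectation P
      (\<lambda>\<omega>. F (averaged_iterate A M K (\<lambda>m t y. g y (z m t \<omega>)) T)) - min_value F \<le> \<epsilon> T (v / real M)"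
proof -
  obtain \<F> where "conditionally_unbiased_run P \<F> A F (v / real M) T
      (\<lambda>t \<omega>. mean_gradient A M K (\<lambda>m t y. g y (z m t \<omega>)) t)"
    using mean_gradient_conditionally_unbiased_run[OF assms(2,5,4,8)] by blast
  moreover have "v / real M \<ge> 0" using \<open>v \<ge> 0\<close> by simp
  ultimately show ?thesis
    unfolding averaged_iterate_eq_iterate[OF assms(2,5)]
    using assms(1,3,6) unfolding guarantees_def by blast
qed

theorem theorem5:
  fixes H B lam \<Delta> \<sigma> :: real
    and A :: "(real ^ 'n) algorithm"
    and \<epsilon>\<^sub>0 \<epsilon>\<^sub>l :: "nat \<Rightarrow> real \<Rightarrow> real"
    and M K R :: nat
    and P :: "'w measure" and Z :: "'z measure"
    and F :: "real ^ 'n \<Rightarrow> real"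
    and g :: "real ^ 'n \<Rightarrow> 'z \<Rightarrow> real ^ 'n"
    and z :: "nat \<Rightarrow> nat \<Rightarrow> 'w \<Rightarrow> 'z"
  assumes "H > 0" and "B > 0" and "lam > 0" and "\<Delta> > 0"
    and "linear_update_algorithm A"
    and "guarantees TYPE('w) A {F \<in> convex_class H B. quadratic F} \<epsilon>\<^sub>0"
    and "guarantees TYPE('w) A {F \<in> strongly_convex_class lam H \<Delta>. quadratic F} \<epsilon>\<^sub>l"
    and "M \<ge> 1" and "K \<ge> 1" and "R \<ge> 1"
    and "quadratic F"
    and "stochastic_gradients P Z F (\<sigma>\<^sup>2) M (K * R) g z"
  shows "(F \<in> convex_class H B \<longrightarrow>
            prob_space.expectation P
              (\<lambda>\<omega>. F (averaged_iterate A M K (\<lambda>m t y. g y (z m t \<omega>)) (K * R))) - min_value F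
            \<le> \<epsilon>\<^sub>0 (K * R) (\<sigma>\<^sup>2 / real M)) \<and>
         (F \<in> strongly_convex_class lam H \<Delta> \<longrightarrow>
            prob_space.expectation P
              (\<lambda>\<omega>. F (averaged_iterate A M K (\<lambda>m t y. g y (z m t \<omega>)) (K * R))) - min_value F
            \<le> \<epsilon>\<^sub>l (K * R) (\<sigma>\<^sup>2 / real M))"
  using guarantees_averaged_iterate[OF assms(6,5) _ assms(11,8) _ _ assms(12)]
    guarantees_averaged_iterate[OF assms(7,5) _ assms(11,8) _ _ assms(12)]
    assms(9-11) by simp

end
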